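(* Let $R$ be a commutative ring with unit, let $G$ be a discrete group, let $X$ be a locally compact, Hausdorff, totally disconnected topological space, and let $\theta=(\{X_g\}_{g\in G},\{\theta_g\}_{g\in G})$ be a partial action of $G$ on $X$ such that each $X_g$ is clopen in $X$. Let $\alpha=(\{D_g\}_{g\in G},\{\alpha_g\}_{g\in G})$ be the corresponding partial action of $G$ on the $R$-algebra $\mathcal{L}_c(X)$, and let $G\ltimes_\theta X$ be the transformation groupoid associated with $\theta$. Then the partial skew group ring $\mathcal{L}_c(X)\rtimes_\alpha G$ and the Steinberg algebra $A_R(G\ltimes_\theta X)$ are isomorphic as $R$-algebras.
   Context: Partial action: a (topological) partial action of a discrete group $G$ on a space $X$ is a family of open subsets $X_g\subseteq X$ and homeomorphisms $\theta_g: X_{g^{-1}}\to X_g$ ($g\in G$) with $X_1=X$, $\theta_1=\mathrm{id}_X$, $\theta_g^{-1}=\theta_{g^{-1}}$, $\theta_g(X_{g^{-1}}\cap X_h)\subseteq X_g\cap X_{gh}$, and $\theta_g(\theta_h(x))=\theta_{gh}(x)$ for all $x\in X_{h^{-1}}\cap X_{h^{-1}g^{-1}}$. $\mathcal{L}_c(X)$: the commutative $R$-algebra (pointwise operations) of locally constant functions $f:X\to R$ with compact support, where $\mathrm{supp}(f)=\{x: f(x)\neq 0\}$. Induced partial action: $D_g=\{f\in\mathcal{L}_c(X): f \text{ vanishes on } X\setminus X_g\}$, an ideal of $\mathcal{L}_c(X)$, and $\alpha_g:D_{g^{-1}}\to D_g$ is $\alpha_g(f)=f\circ\theta_{g^{-1}}$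 on $X_g$, extended by $0$ outside $X_g$. Partial skew group ring: $\mathcal{L}_c(X)\rtimes_\alpha G$ is the set of finite formal sums $\sum_{g\in G} f_g\delta_g$ with $f_g\in D_g$, with componentwise addition and $R$-action, and product the linear extension of $(f_g\delta_g)(f_h\delta_h)=\alpha_g(\alpha_{g^{-1}}(f_g)f_h)\delta_{gh}$. Transformation groupoid: $G\ltimes_\theta X=\{(t,x): t\in G,\ x\in X_t\}$ with the topology inherited from the product $G\times X$; $(t,x)^{-1}=(t^{-1},\theta_{t^{-1}}(x))$; $(s,y),(t,x)$ are composable iff $\theta_{s^{-1}}(y)=x$, and then $(s,y)(t,x)=(st,y)$. So $r(t,x)=(1,x)$ and $s(t,x)=(1,\theta_{t^{-1}}(x))$. It is a Hausdorff ample groupoid. Steinberg algebra: for a Hausdorff ample groupoid $\mathcal{G}$, $A_R(\mathcal{G})$ is the $R$-algebra of all locally constant, compactly supported functions $f:\mathcal{G}\to R$, with pointwise addition and convolution $(f*g)(b)=\sum_{cd=b}f(c)g(d)$. *)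

theory Defs
  imports "HOL-Analysis.Analysis" "HOL-Algebra.Module"
begin

section \<open>Algebras without unit\<close>

text \<open>
  The library locale \<open>algebra\<close> describes commutative unital algebras. Here an \<open>R\<close>-algebra
  is associative, but need neither be commutative nor have a unit. The record type
  \<open>('r, 'a) module\<close> is reused for its structure; its field \<open>one\<close> plays no role, is not
  mentioned in any definition about algebras and is set to \<open>undefined\<close> in the algebras below.
\<close>

locale r_algebra = module R A for R (structure) and A (structure) +
  assumes alg_mult_closed:
      "\<lbrakk>x \<in> carrier A; y \<in> carrier A\<rbrakk> \<Longrightarrow> x \<otimes>\<^bsub>A\<^esub> y \<in> carrier A"
    and alg_mult_assoc:
      "\<lbrakk>x \<in> carrier A; y \<in> carrier A; z \<in> carrier A\<rbrakk>
        \<Longrightarrow> (x \<otimes>\<^bsub>A\<^esub> y) \<otimes>\<^bsub>A\<^esub> z = x \<otimes>\<^bsub>A\<^esub> (y \<otimes>\<^bsub>A\<^esub> z)"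
    and alg_l_distr:
      "\<lbrakk>x \<in> carrier A; y \<in> carrier A; z \<in> carrier A\<rbrakk>
        \<Longrightarrow> (x \<oplus>\<^bsub>A\<^esub> y) \<otimes>\<^bsub>A\<^esub> z = x \<otimes>\<^bsub>A\<^esub> z \<oplus>\<^bsub>A\<^esub> y \<otimes>\<^bsub>A\<^esub> z"
    and alg_r_distr:
      "\<lbrakk>x \<in> carrier A; y \<in> carrier A; z \<in> carrier A\<rbrakk>
        \<Longrightarrow> x \<otimes>\<^bsub>A\<^esub> (y \<oplus>\<^bsub>A\<^esub> z) = x \<otimes>\<^bsub>A\<^esub> y \<oplus>\<^bsub>A\<^esub> x \<otimes>\<^bsub>A\<^esub> z"
    and alg_smult_l:
      "\<lbrakk>a \<in> carrier R; x \<in> carrier A; y \<in> carrier A\<rbrakk>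
        \<Longrightarrow> (a \<odot>\<^bsub>A\<^esub> x) \<otimes>\<^bsub>A\<^esub> y = a \<odot>\<^bsub>A\<^esub> (x \<otimes>\<^bsub>A\<^esub> y)"
    and alg_smult_r:
      "\<lbrakk>a \<in> carrier R; x \<in> carrier A; y \<in> carrier A\<rbrakk>
        \<Longrightarrow> x \<otimes>\<^bsub>A\<^esub> (a \<odot>\<^bsub>A\<^esub> y) = a \<odot>\<^bsub>A\<^esub> (x \<otimes>\<^bsub>A\<^esub> y)"

definition r_algebra_hom ::
    "('r, 'm) ring_scheme \<Rightarrow> ('r, 'a) module \<Rightarrow> ('r, 'b) module \<Rightarrow> ('a \<Rightarrow> 'b) set" where
  "r_algebra_hom R A B =
    {h. h \<in> carrier A \<rightarrow> carrier B \<and>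
        (\<forall>x\<in>carrier A. \<forall>y\<in>carrier A. h (x \<oplus>\<^bsub>A\<^esub> y) = h x \<oplus>\<^bsub>B\<^esub> h y) \<and>
        (\<forall>x\<in>carrier A. \<forall>y\<in>carrier A. h (x \<otimes>\<^bsub>A\<^esub> y) = h x \<otimes>\<^bsub>B\<^esub> h y) \<and>
        (\<forall>a\<in>carrier R. \<forall>x\<in>carrier A. h (a \<odot>\<^bsub>A\<^esub> x) = a \<odot>\<^bsub>B\<^esub> h x)}"

definition r_algebras_isomorphic ::
    "('r, 'm) ring_scheme \<Rightarrow> ('r, 'a) module \<Rightarrow> ('r, 'b) module \<Rightarrow> bool" where
  "r_algebras_isomorphic R A B \<longleftrightarrow>
    r_algebra R A \<and> r_algebra R B \<and>
    (\<exists>h \<in> r_algebra_hom R A B. bij_betw h (carrier A) (carrier B))"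

section \<open>Locally constant functions with compact support\<close>

definition totally_disconnected_space :: "'x topology \<Rightarrow> bool" where
  "totally_disconnected_space X \<longleftrightarrow> (\<forall>S. connectedin X S \<longrightarrow> (\<exists>x. S \<subseteq> {x}))"

definition locally_constant_on_space :: "'x topology \<Rightarrow> ('x \<Rightarrow> 'r) \<Rightarrow> bool" where
  "locally_constant_on_space X f \<longleftrightarrow>
    (\<forall>x\<in>topspace X. \<exists>U. openin X U \<and> x \<in> U \<and> f constant_on U)"

definition supp_on :: "('r, 'm) ring_scheme \<Rightarrow> 'x topology \<Rightarrow> ('x \<Rightarrow> 'r) \<Rightarrow> 'x set" where
  "supp_on R X f = {x \<in> topspace X. f x \<noteq> \<zero>\<^bsub>R\<^esub>}"

text \<open>Functions on a space are represented by extensional functions on its carrier.\<close>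

definition lc_functions :: "('r, 'm) ring_scheme \<Rightarrow> 'x topology \<Rightarrow> ('x \<Rightarrow> 'r) set" where
  "lc_functions R X =
    {f \<in> topspace X \<rightarrow>\<^sub>E carrier R.
      locally_constant_on_space X f \<and> compactin X (supp_on R X f)}"

definition lc_algebra :: "('r, 'm) ring_scheme \<Rightarrow> 'x topology \<Rightarrow> ('r, 'x \<Rightarrow> 'r) module" where
  "lc_algebra R X =
    \<lparr>carrier = lc_functions R X,
     mult = (\<lambda>f g. \<lambda>x\<in>topspace X. f x \<otimes>\<^bsub>R\<^esub> g x),
     one = undefined,
     zero = (\<lambda>x\<in>topspace X. \<zero>\<^bsub>R\<^esub>),
     add = (\<lambda>f g. \<lambda>x\<in>topspace X. f x \<oplus>\<^bsub>R\<^esub> g x),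
     smult = (\<lambda>a f. \<lambda>x\<in>topspace X. a \<otimes>\<^bsub>R\<^esub> f x)\<rparr>"

section \<open>Partial actions\<close>

locale partial_action = group G for G (structure) +
  fixes X :: "'x topology" and Xg :: "'a \<Rightarrow> 'x set" and \<theta> :: "'a \<Rightarrow> 'x \<Rightarrow> 'x"
  assumes pa_open: "g \<in> carrier G \<Longrightarrow> openin X (Xg g)"
    \<comment> \<open>includes that the inverse of \<open>\<theta> g\<close> is \<open>\<theta> (inv g)\<close>\<close>
    and pa_homeo: "g \<in> carrier G \<Longrightarrow>
      homeomorphic_maps (subtopology X (Xg (inv g))) (subtopology X (Xg g)) (\<theta> g) (\<theta> (inv g))"
    and pa_dom_one: "Xg \<one> = topspace X"
    and pa_one: "x \<in> topspace X \<Longrightarrow> \<theta> \<one> x = x"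
    and pa_image: "\<lbrakk>g \<in> carrier G; h \<in> carrier G\<rbrakk> \<Longrightarrow>
      \<theta> g ` (Xg (inv g) \<inter> Xg h) \<subseteq> Xg g \<inter> Xg (g \<otimes> h)"
    and pa_comp: "\<lbrakk>g \<in> carrier G; h \<in> carrier G; x \<in> Xg (inv h) \<inter> Xg (inv h \<otimes> inv g)\<rbrakk> \<Longrightarrow>
      \<theta> g (\<theta> h x) = \<theta> (g \<otimes> h) x"

definition induced_ideal ::
    "('r, 'm) ring_scheme \<Rightarrow> 'x topology \<Rightarrow> ('g \<Rightarrow> 'x set) \<Rightarrow> 'g \<Rightarrow> ('x \<Rightarrow> 'r) set" where
  "induced_ideal R X Xg g =
    {f \<in> carrier (lc_algebra R X). \<forall>x \<in> topspace X - Xg g. f x = \<zero>\<^bsub>R\<^esub>}"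

definition induced_map ::
    "('r, 'm) ring_scheme \<Rightarrow> ('g, 'k) monoid_scheme \<Rightarrow> 'x topology \<Rightarrow> ('g \<Rightarrow> 'x set)
      \<Rightarrow> ('g \<Rightarrow> 'x \<Rightarrow> 'x) \<Rightarrow> 'g \<Rightarrow> ('x \<Rightarrow> 'r) \<Rightarrow> 'x \<Rightarrow> 'r" where
  "induced_map R G X Xg \<theta> g f =
    (\<lambda>x\<in>topspace X. if x \<in> Xg g then f (\<theta> (inv\<^bsub>G\<^esub> g) x) else \<zero>\<^bsub>R\<^esub>)"

text \<open>
  The partial skew group ring of an algebra \<open>A\<close> by a family of ideals \<open>D g\<close> and maps
  \<open>\<alpha> g : D (inv g) \<rightarrow> D g\<close>. The formal sum of the \<open>f\<^sub>g \<delta>\<^sub>g\<close> is the function \<open>g \<mapsto> f\<^sub>g\<close>.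
  In the product the pairs with a zero factor, which contribute nothing, are left out, because
  \<open>finsum\<close> is only meaningful on finite sets.
\<close>

definition partial_skew_group_ring ::
    "('g, 'k) monoid_scheme \<Rightarrow> ('r, 'a) module \<Rightarrow> ('g \<Rightarrow> 'a set) \<Rightarrow> ('g \<Rightarrow> 'a \<Rightarrow> 'a)
      \<Rightarrow> ('r, 'g \<Rightarrow> 'a) module" where
  "partial_skew_group_ring G A D \<alpha> =
    \<lparr>carrier = {F \<in> (\<Pi>\<^sub>E g\<in>carrier G. D g). finite {g \<in> carrier G. F g \<noteq> \<zero>\<^bsub>A\<^esub>}},
     mult = (\<lambda>F H. \<lambda>k\<in>carrier G.
       finsum A (\<lambda>(g, h). \<alpha> g (\<alpha> (inv\<^bsub>G\<^esub> g) (F g) \<otimes>\<^bsub>A\<^esub> H h))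
         {(g, h). g \<in> carrier G \<and> h \<in> carrier G \<and> g \<otimes>\<^bsub>G\<^esub> h = k \<and>
                  F g \<noteq> \<zero>\<^bsub>A\<^esub> \<and> H h \<noteq> \<zero>\<^bsub>A\<^esub>}),
     one = undefined,
     zero = (\<lambda>g\<in>carrier G. \<zero>\<^bsub>A\<^esub>),
     add = (\<lambda>F H. \<lambda>g\<in>carrier G. F g \<oplus>\<^bsub>A\<^esub> H g),
     smult = (\<lambda>a F. \<lambda>g\<in>carrier G. a \<odot>\<^bsub>A\<^esub> F g)\<rparr>"

section \<open>Groupoids and Steinberg algebras\<close>

text \<open>
  A groupoid is given by its space of arrows; units are identified with identity arrows.
  Arrows \<open>c\<close>, \<open>d\<close> are composable iff the source of \<open>c\<close> is the range of \<open>d\<close>.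
\<close>

record 'a topological_groupoid =
  arrows :: "'a topology"
  gsource :: "'a \<Rightarrow> 'a"
  grange :: "'a \<Rightarrow> 'a"
  gmult :: "'a \<Rightarrow> 'a \<Rightarrow> 'a"
  ginverse :: "'a \<Rightarrow> 'a"

definition composable :: "'a topological_groupoid \<Rightarrow> ('a \<times> 'a) set" where
  "composable \<Gamma> =
    {(c, d). c \<in> topspace (arrows \<Gamma>) \<and> d \<in> topspace (arrows \<Gamma>) \<and> gsource \<Gamma> c = grange \<Gamma> d}"

text \<open>
  Intended for Hausdorff ample groupoids, where the set of pairs over which the convolution
  sums is finite. Pairs with a zero factor are again left out.
\<close>

definition steinberg_algebra ::
    "('r, 'm) ring_scheme \<Rightarrow> 'a topological_groupoid \<Rightarrow> ('r, 'a \<Rightarrow> 'r) module" where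
  "steinberg_algebra R \<Gamma> =
    \<lparr>carrier = lc_functions R (arrows \<Gamma>),
     mult = (\<lambda>f g. \<lambda>b\<in>topspace (arrows \<Gamma>).
       finsum R (\<lambda>(c, d). f c \<otimes>\<^bsub>R\<^esub> g d)
         {(c, d). (c, d) \<in> composable \<Gamma> \<and> gmult \<Gamma> c d = b \<and>
                  f c \<noteq> \<zero>\<^bsub>R\<^esub> \<and> g d \<noteq> \<zero>\<^bsub>R\<^esub>}),
     one = undefined,
     zero = (\<lambda>b\<in>topspace (arrows \<Gamma>). \<zero>\<^bsub>R\<^esub>),
     add = (\<lambda>f g. \<lambda>b\<in>topspace (arrows \<Gamma>). f b \<oplus>\<^bsub>R\<^esub> g b),
     smult = (\<lambda>a f. \<lambda>b\<in>topspace (arrows \<Gamma>). a \<otimes>\<^bsub>R\<^esub> f b)\<rparr>"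

definition transformation_groupoid ::
    "('g, 'k) monoid_scheme \<Rightarrow> 'x topology \<Rightarrow> ('g \<Rightarrow> 'x set) \<Rightarrow> ('g \<Rightarrow> 'x \<Rightarrow> 'x)
      \<Rightarrow> ('g \<times> 'x) topological_groupoid" where
  "transformation_groupoid G X Xg \<theta> =
    \<lparr>arrows = subtopology (prod_topology (discrete_topology (carrier G)) X)
       {(t, x). t \<in> carrier G \<and> x \<in> Xg t},
     gsource = (\<lambda>(t, x). (\<one>\<^bsub>G\<^esub>, \<theta> (inv\<^bsub>G\<^esub> t) x)),
     grange = (\<lambda>(t, x). (\<one>\<^bsub>G\<^esub>, x)),
     gmult = (\<lambda>(s, y) (t, x). (s \<otimes>\<^bsub>G\<^esub> t, y)),
     ginverse = (\<lambda>(t, x). (inv\<^bsub>G\<^esub> t, \<theta> (inv\<^bsub>G\<^esub> t) x))\<rparr>"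

end

theory Submission
  imports Defs
begin

text \<open>
  The isomorphism sends \<open>\<Sum>\<^sub>g f\<^sub>g \<delta>\<^sub>g\<close> to the function \<open>(g, x) \<mapsto> f\<^sub>g x\<close>; it is onto because a
  function on the slice over \<open>g\<close> extends by zero from the clopen set \<open>Xg g\<close>. Both products are
  the twisted convolution
  \<open>(F * H) k x = \<Sum>\<^sub>g F g x \<cdot> H (g\<inverse> k) (\<theta> (g\<inverse>) x)\<close>, the sum extending over the \<open>g\<close> with
  \<open>x \<in> Xg g\<close>: on one side \<open>\<alpha> g (\<alpha> (g\<inverse>) f \<cdot> f')\<close> is \<open>f \<cdot> (f' \<circ> \<theta> (g\<inverse>))\<close>, on the other a
  factorisation of \<open>(k, x)\<close> is determined by the group component of its first factor.
\<close>

lemma r_algebra_hom_transport: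
  fixes A :: "('r, 'a) module" and B :: "('r, 'b) module"
  assumes "r_algebra R A" and h: "h \<in> r_algebra_hom R A B"
    and bij: "bij_betw h (carrier A) (carrier B)" and zero: "h \<zero>\<^bsub>A\<^esub> = \<zero>\<^bsub>B\<^esub>"
  shows "r_algebra R B"
proof -
  interpret A: r_algebra R A by fact
  have im: "carrier B = h ` carrier A" using bij by (simp add: bij_betw_def)
  have add [symmetric]: "\<And>x y. \<lbrakk>x \<in> carrier A; y \<in> carrier A\<rbrakk> \<Longrightarrow> h (x \<oplus>\<^bsub>A\<^esub> y) = h x \<oplus>\<^bsub>B\<^esub> h y"
    and mult [symmetric]: "\<And>x y. \<lbrakk>x \<in> carrier A; y \<in> carrier A\<rbrakk> \<Longrightarrow> h (x \<otimes>\<^bsub>A\<^esub> y) = h x \<otimes>\<^bsub>B\<^esub> h y"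
    and smult [symmetric]: "\<And>a x. \<lbrakk>a \<in> carrier R; x \<in> carrier A\<rbrakk> \<Longrightarrow> h (a \<odot>\<^bsub>A\<^esub> x) = a \<odot>\<^bsub>B\<^esub> h x"
    using h by (auto simp: r_algebra_hom_def)
  note ops = add mult smult zero[symmetric] A.alg_mult_closed
  have "abelian_group B"
  proof (rule abelian_groupI)
    fix x assume "x \<in> carrier B"
    then obtain x' where "x' \<in> carrier A" "x = h x'" by (auto simp: im)
    then show "\<exists>y\<in>carrier B. y \<oplus>\<^bsub>B\<^esub> x = \<zero>\<^bsub>B\<^esub>"
      by (intro bexI[of _ "h (\<ominus>\<^bsub>A\<^esub> x')"]) (auto simp: im ops A.l_neg)
  qed (auto simp: im ops A.M.a_ac)
  then have "module R B"
    by (intro moduleI A.R.cring_axioms)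
      (auto simp: im ops A.smult_l_distr A.smult_r_distr A.smult_assoc1)
  then show ?thesis
    by (intro r_algebra.intro r_algebra_axioms.intro)
      (auto simp: im ops A.alg_mult_assoc A.alg_l_distr A.alg_r_distr A.alg_smult_l A.alg_smult_r)
qed

lemma (in abelian_monoid) finsum_swap:
  assumes "finite S" "finite T" "\<And>i j. \<lbrakk>i \<in> S; j \<in> T\<rbrakk> \<Longrightarrow> f i j \<in> carrier G"
  shows "(\<Oplus>i\<in>S. \<Oplus>j\<in>T. f i j) = (\<Oplus>j\<in>T. \<Oplus>i\<in>S. f i j)"
  using assms
proof (induction S rule: finite_induct)
  case empty
  then show ?case by simp
next
  case (insert i S)
  have "(\<Oplus>k\<in>insert i S. \<Oplus>j\<in>T. f k j) = (\<Oplus>j\<in>T. f i j) \<oplus> (\<Oplus>k\<in>S. \<Oplus>j\<in>T. f k j)"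
    using insert by (intro finsum_insert) (auto intro!: finsum_closed)
  also have "\<dots> = (\<Oplus>j\<in>T. f i j) \<oplus> (\<Oplus>j\<in>T. \<Oplus>k\<in>S. f k j)"
    using insert by simp
  also have "\<dots> = (\<Oplus>j\<in>T. f i j \<oplus> (\<Oplus>k\<in>S. f k j))"
    using insert by (intro finsum_addf[symmetric]) (auto intro!: finsum_closed)
  also have "\<dots> = (\<Oplus>j\<in>T. \<Oplus>k\<in>insert i S. f k j)"
    using insert by (intro finsum_cong') (auto intro!: finsum_closed)
  finally show ?case .
qed

section \<open>The module of locally constant functions\<close>

lemma openin_locally_constant_vimage:
  assumes "locally_constant_on_space Y f"
  shows "openin Y {x \<in> topspace Y. P (f x)}"
proof (subst openin_subopen, intro ballI)
  fix x assume x: "x \<in> {x \<in> topspace Y. P (f x)}"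
  then obtain U where "openin Y U" "x \<in> U" "f constant_on U"
    using assms by (auto simp: locally_constant_on_space_def)
  with x show "\<exists>T. openin Y T \<and> x \<in> T \<and> T \<subseteq> {x \<in> topspace Y. P (f x)}"
    by (intro exI[of _ U]) (auto simp: constant_on_def dest: openin_subset)
qed

lemma closedin_supp_on:
  assumes "locally_constant_on_space Y f"
  shows "closedin Y (supp_on R Y f)"
proof -
  have "topspace Y - supp_on R Y f = {x \<in> topspace Y. f x = \<zero>\<^bsub>R\<^esub>}"
    by (auto simp: supp_on_def)
  with openin_locally_constant_vimage[OF assms, of "\<lambda>r. r = \<zero>\<^bsub>R\<^esub>"] show ?thesis
    by (auto simp: closedin_def supp_on_def)
qed

lemma locally_constant_combine:
  assumes "locally_constant_on_space Y f" "locally_constant_on_space Y g"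
  shows "locally_constant_on_space Y (\<lambda>x\<in>topspace Y. q (f x) (g x))"
  unfolding locally_constant_on_space_def
proof
  fix x assume "x \<in> topspace Y"
  then obtain U V where "openin Y U" "x \<in> U" "f constant_on U" "openin Y V" "x \<in> V" "g constant_on V"
    using assms by (meson locally_constant_on_space_def)
  moreover have "U \<inter> V \<subseteq> topspace Y" using \<open>openin Y U\<close> openin_subset by blast
  ultimately show "\<exists>U. openin Y U \<and> x \<in> U \<and> (\<lambda>x\<in>topspace Y. q (f x) (g x)) constant_on U"
    by (intro exI[of _ "U \<inter> V"]) (force simp: constant_on_def)
qed

lemma lc_functionsI:
  assumes "f \<in> topspace Y \<rightarrow>\<^sub>E carrier R" "locally_constant_on_space Y f"
    and "compactin Y K" "supp_on R Y f \<subseteq> K"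
  shows "f \<in> lc_functions R Y"
  using assms closedin_supp_on[OF assms(2)] closed_compactin[OF assms(3,4)]
  by (auto simp: lc_functions_def)

lemma lc_functions_combine:
  assumes f: "f \<in> lc_functions R Y" and g: "g \<in> lc_functions R Y"
    and "\<And>a b. \<lbrakk>a \<in> carrier R; b \<in> carrier R\<rbrakk> \<Longrightarrow> q a b \<in> carrier R" "q \<zero>\<^bsub>R\<^esub> \<zero>\<^bsub>R\<^esub> = \<zero>\<^bsub>R\<^esub>"
  shows "(\<lambda>x\<in>topspace Y. q (f x) (g x)) \<in> lc_functions R Y"
proof (rule lc_functionsI)
  show "compactin Y (supp_on R Y f \<union> supp_on R Y g)"
    using f g by (auto simp: lc_functions_def intro: compactin_Un)
qed (use assms in \<open>auto simp: lc_functions_def supp_on_def intro: locally_constant_combine\<close>)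

lemma lc_functions_zero:
  assumes "cring R"
  shows "(\<lambda>x\<in>topspace Y. \<zero>\<^bsub>R\<^esub>) \<in> lc_functions R Y"
proof -
  interpret cring R by fact
  show ?thesis
  proof (rule lc_functionsI)
    show "locally_constant_on_space Y (\<lambda>x\<in>topspace Y. \<zero>\<^bsub>R\<^esub>)"
      unfolding locally_constant_on_space_def
      by (auto intro!: exI[of _ "topspace Y"] simp: constant_on_def)
    show "compactin Y {}" by simp
  qed (auto simp: supp_on_def)
qed

lemma lc_functions_closed [intro]:
  "\<lbrakk>f \<in> lc_functions R Y; x \<in> topspace Y\<rbrakk> \<Longrightarrow> f x \<in> carrier R"
  by (auto simp: lc_functions_def)

lemma lc_functions_extensional: "f \<in> lc_functions R Y \<Longrightarrow> f \<in> extensional (topspace Y)"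
  by (auto simp: lc_functions_def PiE_def)

lemma lc_functions_ext:
  assumes "f \<in> extensional (topspace Y)" "g \<in> lc_functions R Y" "\<And>x. x \<in> topspace Y \<Longrightarrow> f x = g x"
  shows "f = g"
  using assms lc_functions_extensional extensionalityI by metis

lemma module_lc_algebra:
  assumes "cring R"
  shows "module R (lc_algebra R Y)"
proof -
  interpret R: cring R by fact
  have add: "(\<lambda>x\<in>topspace Y. f x \<oplus>\<^bsub>R\<^esub> g x) \<in> lc_functions R Y"
    if "f \<in> lc_functions R Y" "g \<in> lc_functions R Y" for f g
    using that by (intro lc_functions_combine) auto
  have smult: "(\<lambda>x\<in>topspace Y. a \<otimes>\<^bsub>R\<^esub> f x) \<in> lc_functions R Y"
    if "a \<in> carrier R" "f \<in> lc_functions R Y" for a f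
    using that lc_functions_combine[OF that(2) that(2), of "\<lambda>b _. a \<otimes>\<^bsub>R\<^esub> b"] by auto
  have neg: "(\<lambda>x\<in>topspace Y. \<ominus>\<^bsub>R\<^esub> f x) \<in> lc_functions R Y" if "f \<in> lc_functions R Y" for f
    using lc_functions_combine[OF that that, of "\<lambda>b _. \<ominus>\<^bsub>R\<^esub> b"] by auto
  have ab: "abelian_group (lc_algebra R Y)"
  proof (rule abelian_groupI)
    fix f assume f: "f \<in> carrier (lc_algebra R Y)"
    show "\<zero>\<^bsub>lc_algebra R Y\<^esub> \<oplus>\<^bsub>lc_algebra R Y\<^esub> f = f"
      using f by (auto simp: lc_algebra_def lc_functions_closed intro!: lc_functions_ext)
    show "\<exists>g\<in>carrier (lc_algebra R Y). g \<oplus>\<^bsub>lc_algebra R Y\<^esub> f = \<zero>\<^bsub>lc_algebra R Y\<^esub>"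
      using f neg
      by (intro bexI[of _ "\<lambda>x\<in>topspace Y. \<ominus>\<^bsub>R\<^esub> f x"])
        (auto simp: lc_algebra_def intro!: restrict_ext R.l_neg)
  qed (auto simp: lc_algebra_def add lc_functions_zero[OF assms] intro!: restrict_ext R.a_assoc R.a_comm)
  show ?thesis
  proof (rule moduleI[OF assms ab])
    show "\<one>\<^bsub>R\<^esub> \<odot>\<^bsub>lc_algebra R Y\<^esub> f = f" if "f \<in> carrier (lc_algebra R Y)" for f
      using that by (auto simp: lc_algebra_def lc_functions_closed intro!: lc_functions_ext)
  qed (auto simp: lc_algebra_def smult R.l_distr R.r_distr R.m_assoc lc_functions_closed intro!: restrict_ext)
qed

lemma lc_algebra_finsum_apply:
  assumes R: "cring R" and x: "x \<in> topspace Y"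
    and f: "\<And>i. i \<in> S \<Longrightarrow> f i \<in> carrier (lc_algebra R Y)"
  shows "finsum (lc_algebra R Y) f S x = finsum R (\<lambda>i. f i x) S"
proof -
  interpret R: cring R by fact
  interpret A: module R "lc_algebra R Y" by (rule module_lc_algebra[OF R])
  have [simp]: "\<zero>\<^bsub>lc_algebra R Y\<^esub> x = \<zero>\<^bsub>R\<^esub>" using x by (simp add: lc_algebra_def)
  show ?thesis using f
  proof (induction S rule: infinite_finite_induct)
    case (insert i S)
    have c: "f i x \<in> carrier R" if "i \<in> insert i S" "f i \<in> carrier (lc_algebra R Y)" for i
      using that x by (auto simp: lc_algebra_def)
    have "finsum (lc_algebra R Y) f (insert i S) x
        = (f i \<oplus>\<^bsub>lc_algebra R Y\<^esub> finsum (lc_algebra R Y) f S) x"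
      using insert by (subst A.M.finsum_insert) auto
    also have "\<dots> = f i x \<oplus>\<^bsub>R\<^esub> finsum R (\<lambda>i. f i x) S"
      using insert x by (simp add: lc_algebra_def)
    also have "\<dots> = finsum R (\<lambda>i. f i x) (insert i S)"
      using insert c by (intro R.finsum_insert[symmetric]) auto
    finally show ?case .
  qed simp_all
qed

section \<open>The module structure of a partial skew group ring\<close>

lemma module_partial_skew_group_ring:
  assumes "module R A" and D: "\<And>g. g \<in> carrier G \<Longrightarrow> submodule (D g) R A"
  shows "module R (partial_skew_group_ring G A D \<alpha>)" (is "module R ?P")
proof -
  interpret A: module R A by fact
  have carrier: "carrier ?P = {F \<in> (\<Pi>\<^sub>E g\<in>carrier G. D g). finite {g \<in> carrier G. F g \<noteq> \<zero>\<^bsub>A\<^esub>}}"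
    and zero: "\<zero>\<^bsub>?P\<^esub> = (\<lambda>g\<in>carrier G. \<zero>\<^bsub>A\<^esub>)"
    and add: "\<And>F H. F \<oplus>\<^bsub>?P\<^esub> H = (\<lambda>g\<in>carrier G. F g \<oplus>\<^bsub>A\<^esub> H g)"
    and smult: "\<And>a F. a \<odot>\<^bsub>?P\<^esub> F = (\<lambda>g\<in>carrier G. a \<odot>\<^bsub>A\<^esub> F g)"
    by (simp_all add: partial_skew_group_ring_def)
  note subE = A.submoduleE[OF D]
  have D_zero: "\<zero>\<^bsub>A\<^esub> \<in> D g" if "g \<in> carrier G" for g
    using subgroup.one_closed[OF submodule.axioms(1)[OF D[OF that]]] by simp
  have cl: "F g \<in> carrier A" if "F \<in> carrier ?P" "g \<in> carrier G" for F g
    using that subE(1) by (fastforce simp: carrier)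
  have add_closed: "F \<oplus>\<^bsub>?P\<^esub> H \<in> carrier ?P" if "F \<in> carrier ?P" "H \<in> carrier ?P" for F H
  proof -
    have "finite ({g \<in> carrier G. F g \<noteq> \<zero>\<^bsub>A\<^esub>} \<union> {g \<in> carrier G. H g \<noteq> \<zero>\<^bsub>A\<^esub>})"
      using that by (auto simp: carrier)
    then have "finite {g \<in> carrier G. F g \<oplus>\<^bsub>A\<^esub> H g \<noteq> \<zero>\<^bsub>A\<^esub>}"
      by (rule rev_finite_subset) auto
    moreover have "F g \<oplus>\<^bsub>A\<^esub> H g \<in> D g" if "g \<in> carrier G" for g
      using that \<open>F \<in> carrier ?P\<close> \<open>H \<in> carrier ?P\<close> by (intro subE(5)) (auto simp: carrier)
    ultimately show ?thesis by (auto simp: carrier add cong: conj_cong)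
  qed
  have image_closed: "(\<lambda>g\<in>carrier G. q (F g)) \<in> carrier ?P"
    if "F \<in> carrier ?P" "q \<zero>\<^bsub>A\<^esub> = \<zero>\<^bsub>A\<^esub>" "\<And>g x. \<lbrakk>g \<in> carrier G; x \<in> D g\<rbrakk> \<Longrightarrow> q x \<in> D g" for F q
  proof -
    have "finite {g \<in> carrier G. F g \<noteq> \<zero>\<^bsub>A\<^esub>}" using that by (auto simp: carrier)
    then have "finite {g \<in> carrier G. q (F g) \<noteq> \<zero>\<^bsub>A\<^esub>}"
      by (rule rev_finite_subset) (use that in auto)
    then show ?thesis using that by (auto simp: carrier cong: conj_cong)
  qed
  have ext: "F = H" if "F \<in> extensional (carrier G)" "H \<in> carrier ?P" "\<And>g. g \<in> carrier G \<Longrightarrow> F g = H g" for F H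
    using that by (intro extensionalityI[of F "carrier G" H]) (auto simp: carrier PiE_def)
  have "abelian_group ?P"
  proof (rule abelian_groupI)
    show "\<zero>\<^bsub>?P\<^esub> \<in> carrier ?P" by (simp add: carrier zero D_zero)
    fix F assume F: "F \<in> carrier ?P"
    show "\<zero>\<^bsub>?P\<^esub> \<oplus>\<^bsub>?P\<^esub> F = F"
      using F by (intro ext) (auto simp: zero add cl)
    show "\<exists>H\<in>carrier ?P. H \<oplus>\<^bsub>?P\<^esub> F = \<zero>\<^bsub>?P\<^esub>"
      using F subE(3)
      by (intro bexI[of _ "\<lambda>g\<in>carrier G. \<ominus>\<^bsub>A\<^esub> F g"] image_closed)
        (auto simp: zero add cl A.M.l_neg intro!: restrict_ext)
  next
    show "(F \<oplus>\<^bsub>?P\<^esub> H) \<oplus>\<^bsub>?P\<^esub> K = F \<oplus>\<^bsub>?P\<^esub> (H \<oplus>\<^bsub>?P\<^esub> K)"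
      if "F \<in> carrier ?P" "H \<in> carrier ?P" "K \<in> carrier ?P" for F H K
      using that cl by (auto simp: add A.M.a_assoc intro!: restrict_ext)
    show "F \<oplus>\<^bsub>?P\<^esub> H = H \<oplus>\<^bsub>?P\<^esub> F" if "F \<in> carrier ?P" "H \<in> carrier ?P" for F H
      using that cl by (auto simp: add A.M.a_comm intro!: restrict_ext)
  qed (fact add_closed)
  then show ?thesis
  proof (rule moduleI[OF A.R.cring_axioms])
    show "a \<odot>\<^bsub>?P\<^esub> F \<in> carrier ?P" if "a \<in> carrier R" "F \<in> carrier ?P" for a F
      unfolding smult using that subE(4) by (intro image_closed) auto
    show "\<one>\<^bsub>R\<^esub> \<odot>\<^bsub>?P\<^esub> F = F" if "F \<in> carrier ?P" for F
      using that by (intro ext) (auto simp: smult cl)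
  qed (auto simp: smult add cl A.smult_l_distr A.smult_r_distr A.smult_assoc1 intro!: restrict_ext)
qed

section \<open>Convolution for a partial action by clopen sets\<close>

locale clopen_partial_action = partial_action G X Xg \<theta> + R: cring R
  for G :: "('g, 'k) monoid_scheme" (structure) and X :: "'x topology" and Xg \<theta>
    and R :: "('r, 'm) ring_scheme" +
  assumes closed: "g \<in> carrier G \<Longrightarrow> closedin X (Xg g)"
begin

abbreviation "A \<equiv> lc_algebra R X"
abbreviation "D \<equiv> induced_ideal R X Xg"
abbreviation "\<alpha> \<equiv> induced_map R G X Xg \<theta>"
abbreviation "P \<equiv> partial_skew_group_ring G A D \<alpha>"
abbreviation "\<Gamma> \<equiv> transformation_groupoid G X Xg \<theta>"
abbreviation "St \<equiv> steinberg_algebra R \<Gamma>"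
abbreviation "supp F \<equiv> {g \<in> carrier G. F g \<noteq> \<zero>\<^bsub>A\<^esub>}"

sublocale A: module R A
  by (rule module_lc_algebra) (rule R.cring_axioms)

lemma Xg_subset: "\<lbrakk>g \<in> carrier G; x \<in> Xg g\<rbrakk> \<Longrightarrow> x \<in> topspace X"
  using openin_subset[OF pa_open] by blast

lemma theta_in: "\<lbrakk>g \<in> carrier G; x \<in> Xg (inv g)\<rbrakk> \<Longrightarrow> \<theta> g x \<in> Xg g"
  using pa_homeo[of g] openin_subset[OF pa_open, of "inv g"] openin_subset[OF pa_open, of g]
  by (auto simp: homeomorphic_maps_def continuous_map_def inf.absorb2)

lemma theta_inv_in: "\<lbrakk>g \<in> carrier G; x \<in> Xg g\<rbrakk> \<Longrightarrow> \<theta> (inv g) x \<in> Xg (inv g)"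
  using theta_in[of "inv g" x] by simp

lemma theta_inv_topspace: "\<lbrakk>g \<in> carrier G; x \<in> Xg g\<rbrakk> \<Longrightarrow> \<theta> (inv g) x \<in> topspace X"
  using theta_inv_in Xg_subset inv_closed by blast

lemma theta_theta_inv: "\<lbrakk>g \<in> carrier G; x \<in> Xg g\<rbrakk> \<Longrightarrow> \<theta> g (\<theta> (inv g) x) = x"
  using pa_homeo[of g] openin_subset[OF pa_open, of g]
  by (auto simp: homeomorphic_maps_def)

lemma theta_inv_in_iff:
  assumes g: "g \<in> carrier G" and k: "k \<in> carrier G" and x: "x \<in> Xg g"
  shows "\<theta> (inv g) x \<in> Xg (inv g \<otimes> k) \<longleftrightarrow> x \<in> Xg k"
proof
  assume "\<theta> (inv g) x \<in> Xg (inv g \<otimes> k)"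
  then have "\<theta> g (\<theta> (inv g) x) \<in> Xg (g \<otimes> (inv g \<otimes> k))"
    using pa_image[of g "inv g \<otimes> k"] theta_inv_in assms by auto
  then show "x \<in> Xg k"
    using assms theta_theta_inv by (simp add: m_assoc[symmetric])
next
  assume "x \<in> Xg k"
  then show "\<theta> (inv g) x \<in> Xg (inv g \<otimes> k)"
    using pa_image[of "inv g" k] assms by auto
qed

lemma theta_inv_comp:
  assumes "s \<in> carrier G" "g \<in> carrier G" "x \<in> Xg s" "x \<in> Xg g"
  shows "\<theta> (inv (inv s \<otimes> g)) (\<theta> (inv s) x) = \<theta> (inv g) x"
proof -
  have inv: "inv (inv s \<otimes> g) = inv g \<otimes> s" using assms(1,2) by (simp add: inv_mult_group)
  have "s \<otimes> (inv s \<otimes> g) = g" using assms(1,2) by (simp add: m_assoc[symmetric])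
  moreover have "inv g \<otimes> s \<otimes> inv s = inv g" using assms(1,2) by (simp add: m_assoc)
  ultimately show ?thesis
    using pa_comp[of "inv (inv s \<otimes> g)" "inv s" x] assms by (simp add: inv inv_mult_group)
qed

lemma A_simps: "carrier A = lc_functions R X" "\<zero>\<^bsub>A\<^esub> = (\<lambda>x\<in>topspace X. \<zero>\<^bsub>R\<^esub>)"
  "f \<otimes>\<^bsub>A\<^esub> f' = (\<lambda>x\<in>topspace X. f x \<otimes>\<^bsub>R\<^esub> f' x)"
  "f \<oplus>\<^bsub>A\<^esub> f' = (\<lambda>x\<in>topspace X. f x \<oplus>\<^bsub>R\<^esub> f' x)"
  "a \<odot>\<^bsub>A\<^esub> f = (\<lambda>x\<in>topspace X. a \<otimes>\<^bsub>R\<^esub> f x)"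
  by (simp_all add: lc_algebra_def)

lemma A_apply_closed: "\<lbrakk>f \<in> carrier A; x \<in> topspace X\<rbrakk> \<Longrightarrow> f x \<in> carrier R"
  by (auto simp: A_simps)

lemma D_subset: "f \<in> D g \<Longrightarrow> f \<in> carrier A"
  by (simp add: induced_ideal_def)

lemma D_vanish: "\<lbrakk>f \<in> D g; x \<in> topspace X; x \<notin> Xg g\<rbrakk> \<Longrightarrow> f x = \<zero>\<^bsub>R\<^esub>"
  by (simp add: induced_ideal_def)

lemma A_minus_apply:
  assumes f: "f \<in> carrier A" and x: "x \<in> topspace X"
  shows "(\<ominus>\<^bsub>A\<^esub> f) x = \<ominus>\<^bsub>R\<^esub> f x"
proof -
  have "(\<ominus>\<^bsub>A\<^esub> f \<oplus>\<^bsub>A\<^esub> f) x = \<zero>\<^bsub>A\<^esub> x" using A.M.l_neg[OF f] by simp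
  then have "(\<ominus>\<^bsub>A\<^esub> f) x \<oplus>\<^bsub>R\<^esub> f x = \<zero>\<^bsub>R\<^esub>" using x by (simp add: A_simps(2,4))
  then show ?thesis
    by (rule R.minus_equality[symmetric]) (intro A_apply_closed A.M.a_inv_closed f x)+
qed

lemma submodule_D: "submodule (D g) R A"
proof (rule A.submoduleI)
  show "\<And>f. f \<in> D g \<Longrightarrow> \<ominus>\<^bsub>A\<^esub> f \<in> D g"
    by (auto simp: induced_ideal_def A_minus_apply)
  show "\<zero>\<^bsub>A\<^esub> \<in> D g" using A.M.zero_closed by (auto simp: induced_ideal_def A_simps)
  show "f \<oplus>\<^bsub>A\<^esub> f' \<in> D g" if "f \<in> D g" "f' \<in> D g" for f f'
    using that A.M.a_closed[of f f'] by (auto simp: induced_ideal_def A_simps)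
  show "a \<odot>\<^bsub>A\<^esub> f \<in> D g" if "a \<in> carrier R" "f \<in> D g" for a f
    using that A.smult_closed[of a f] by (auto simp: induced_ideal_def A_simps)
qed (auto simp: D_subset)

lemma D_mult:
  assumes "f \<in> D g" "f' \<in> carrier A"
  shows "f \<otimes>\<^bsub>A\<^esub> f' \<in> D g"
  using assms lc_functions_combine[of f R X f' "\<lambda>a b. a \<otimes>\<^bsub>R\<^esub> b"] D_subset[OF assms(1)]
  by (auto simp: induced_ideal_def A_simps lc_functions_closed)

lemma alpha_closed:
  assumes g: "g \<in> carrier G" and f: "f \<in> D (inv g)"
  shows "\<alpha> g f \<in> D g"
proof -
  have f': "f \<in> lc_functions R X" using D_subset[OF f] by (simp add: A_simps)
  have cont: "continuous_map (subtopology X (Xg (inv g))) (subtopology X (Xg g)) (\<theta> g)"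
    and cont': "continuous_map (subtopology X (Xg g)) (subtopology X (Xg (inv g))) (\<theta> (inv g))"
    using pa_homeo[OF g] by (auto simp: homeomorphic_maps_def)
  have "\<alpha> g f \<in> lc_functions R X"
  proof (rule lc_functionsI)
    show "\<alpha> g f \<in> topspace X \<rightarrow>\<^sub>E carrier R"
      using f' g theta_inv_topspace by (auto simp: induced_map_def lc_functions_closed)
    show "locally_constant_on_space X (\<alpha> g f)"
      unfolding locally_constant_on_space_def
    proof
      fix x assume x: "x \<in> topspace X"
      show "\<exists>U. openin X U \<and> x \<in> U \<and> \<alpha> g f constant_on U"
      proof (cases "x \<in> Xg g")
        case True
        then obtain V where V: "openin X V" "\<theta> (inv g) x \<in> V" "f constant_on V"
          using f' theta_inv_topspace[OF g True]
          by (auto simp: lc_functions_def locally_constant_on_space_def)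
        have "openin (subtopology X (Xg g)) {y \<in> topspace (subtopology X (Xg g)). \<theta> (inv g) y \<in> V}"
          using continuous_map_into_fulltopology[OF cont'] V(1) by (rule openin_continuous_map_preimage)
        then have "openin X {y \<in> Xg g. \<theta> (inv g) y \<in> V}"
          using openin_open_subtopology[OF pa_open[OF g]] openin_subset[OF pa_open[OF g]]
          by (simp add: inf.absorb2)
        moreover have "\<alpha> g f constant_on {y \<in> Xg g. \<theta> (inv g) y \<in> V}"
          using V(3) Xg_subset[OF g] by (auto simp: constant_on_def induced_map_def)
        ultimately show ?thesis using True V(2) by blast
      next
        case False
        then show ?thesis
          using closed[OF g] x
          by (intro exI[of _ "topspace X - Xg g"]) (auto simp: constant_on_def induced_map_def)
      qed
    qed
    have "supp_on R X f \<subseteq> Xg (inv g)"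
      using D_vanish[OF f] by (auto simp: supp_on_def)
    then have "compactin (subtopology X (Xg (inv g))) (supp_on R X f)"
      using f' by (simp add: compactin_subtopology lc_functions_def)
    from image_compactin[OF this continuous_map_into_fulltopology[OF cont]]
    show "compactin X (\<theta> g ` supp_on R X f)" .
    show "supp_on R X (\<alpha> g f) \<subseteq> \<theta> g ` supp_on R X f"
    proof
      fix x assume "x \<in> supp_on R X (\<alpha> g f)"
      then have x: "x \<in> Xg g" "f (\<theta> (inv g) x) \<noteq> \<zero>\<^bsub>R\<^esub>"
        by (auto simp: supp_on_def induced_map_def split: if_splits)
      then have "\<theta> (inv g) x \<in> supp_on R X f"
        using theta_inv_topspace[OF g] by (simp add: supp_on_def)
      then show "x \<in> \<theta> g ` supp_on R X f"
        using theta_theta_inv[OF g x(1)] by (metis imageI)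
    qed
  qed
  then show ?thesis by (auto simp: induced_ideal_def induced_map_def A_simps)
qed

lemma skew_term_closed:
  assumes "g \<in> carrier G" "f \<in> D g" "f' \<in> carrier A"
  shows "\<alpha> g (\<alpha> (inv g) f \<otimes>\<^bsub>A\<^esub> f') \<in> D g"
  using assms alpha_closed[of "inv g" f] by (intro alpha_closed D_mult) auto

lemma skew_term_apply:
  assumes g: "g \<in> carrier G" and x: "x \<in> topspace X"
  shows "\<alpha> g (\<alpha> (inv g) f \<otimes>\<^bsub>A\<^esub> f') x =
    (if x \<in> Xg g then f x \<otimes>\<^bsub>R\<^esub> f' (\<theta> (inv g) x) else \<zero>\<^bsub>R\<^esub>)"
  using assms theta_inv_topspace theta_inv_in theta_theta_inv
  by (auto simp: induced_map_def A_simps)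

lemma P_carrier: "F \<in> carrier P \<longleftrightarrow> F \<in> (\<Pi>\<^sub>E g\<in>carrier G. D g) \<and> finite (supp F)"
  by (simp add: partial_skew_group_ring_def)

lemma P_D: "\<lbrakk>F \<in> carrier P; g \<in> carrier G\<rbrakk> \<Longrightarrow> F g \<in> D g"
  by (auto simp: P_carrier)

lemma P_A: "\<lbrakk>F \<in> carrier P; g \<in> carrier G\<rbrakk> \<Longrightarrow> F g \<in> carrier A"
  by (rule D_subset) (rule P_D)

lemma P_apply_closed: "\<lbrakk>F \<in> carrier P; g \<in> carrier G; x \<in> topspace X\<rbrakk> \<Longrightarrow> F g x \<in> carrier R"
  by (intro A_apply_closed P_A)

lemma P_vanish: "\<lbrakk>F \<in> carrier P; g \<in> carrier G; x \<in> topspace X; x \<notin> Xg g\<rbrakk> \<Longrightarrow> F g x = \<zero>\<^bsub>R\<^esub>"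
  by (rule D_vanish) (rule P_D)

lemma P_off_supp: "\<lbrakk>g \<in> carrier G; g \<notin> supp F; x \<in> topspace X\<rbrakk> \<Longrightarrow> F g x = \<zero>\<^bsub>R\<^esub>"
  by (simp add: A_simps(2))

lemma P_supp_finite: "F \<in> carrier P \<Longrightarrow> finite (supp F)"
  by (simp add: P_carrier)

lemma P_ext:
  assumes "F \<in> carrier P" "H \<in> carrier P"
    and "\<And>k x. \<lbrakk>k \<in> carrier G; x \<in> topspace X\<rbrakk> \<Longrightarrow> F k x = H k x"
  shows "F = H"
proof (rule extensionalityI)
  show "F k = H k" if "k \<in> carrier G" for k
    using assms that P_A[of F k] P_A[of H k]
    by (intro lc_functions_ext[of _ X _ R]) (auto simp: A_simps lc_functions_extensional)
qed (use assms in \<open>auto simp: P_carrier PiE_def\<close>)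

sublocale P: module R P
  using A.module_axioms submodule_D by (rule module_partial_skew_group_ring)

lemma P_add_apply: "\<lbrakk>g \<in> carrier G; x \<in> topspace X\<rbrakk> \<Longrightarrow> (F \<oplus>\<^bsub>P\<^esub> H) g x = F g x \<oplus>\<^bsub>R\<^esub> H g x"
  by (simp add: partial_skew_group_ring_def A_simps)

lemma P_smult_apply: "\<lbrakk>g \<in> carrier G; x \<in> topspace X\<rbrakk> \<Longrightarrow> (a \<odot>\<^bsub>P\<^esub> F) g x = a \<otimes>\<^bsub>R\<^esub> F g x"
  by (simp add: partial_skew_group_ring_def A_simps)

definition conv_term where
  "conv_term F H k x g =
    (if x \<in> Xg g then F g x \<otimes>\<^bsub>R\<^esub> H (inv g \<otimes> k) (\<theta> (inv g) x) else \<zero>\<^bsub>R\<^esub>)"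

lemma conv_term_closed:
  assumes "F \<in> carrier P" "H \<in> carrier P" "k \<in> carrier G" "g \<in> carrier G"
  shows "conv_term F H k x g \<in> carrier R"
  using assms by (simp add: conv_term_def P_apply_closed Xg_subset theta_inv_topspace)

lemma conv_term_zero:
  assumes "F \<in> carrier P" "H \<in> carrier P" "k \<in> carrier G" "g \<in> carrier G"
    and "g \<notin> supp F \<or> inv g \<otimes> k \<notin> supp H"
  shows "conv_term F H k x g = \<zero>\<^bsub>R\<^esub>"
proof (cases "x \<in> Xg g")
  case True
  then have "x \<in> topspace X" "\<theta> (inv g) x \<in> topspace X" "inv g \<otimes> k \<in> carrier G"
    using assms by (simp_all add: Xg_subset theta_inv_topspace)
  then show ?thesis
    using assms P_off_supp[of g F x] P_off_supp[of "inv g \<otimes> k" H "\<theta> (inv g) x"]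
    by (auto simp: conv_term_def P_apply_closed)
qed (simp add: conv_term_def)

lemma skew_mult_component:
  assumes F: "F \<in> carrier P" and H: "H \<in> carrier P" and k: "k \<in> carrier G"
  defines "J \<equiv> {g \<in> carrier G. g \<in> supp F \<and> inv g \<otimes> k \<in> supp H}"
  shows "(F \<otimes>\<^bsub>P\<^esub> H) k = finsum A (\<lambda>g. \<alpha> g (\<alpha> (inv g) (F g) \<otimes>\<^bsub>A\<^esub> H (inv g \<otimes> k))) J"
proof -
  let ?I = "{(g, h). g \<in> carrier G \<and> h \<in> carrier G \<and> g \<otimes> h = k \<and> F g \<noteq> \<zero>\<^bsub>A\<^esub> \<and> H h \<noteq> \<zero>\<^bsub>A\<^esub>}"
  have "g \<otimes> h = k \<longleftrightarrow> h = inv g \<otimes> k" if "g \<in> carrier G" "h \<in> carrier G" for g h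
    using inv_solve_left[of h g k] that k by auto
  then have I: "?I = (\<lambda>g. (g, inv g \<otimes> k)) ` J"
    using k by (fastforce simp: J_def)
  have "(F \<otimes>\<^bsub>P\<^esub> H) k = finsum A (\<lambda>(g, h). \<alpha> g (\<alpha> (inv g) (F g) \<otimes>\<^bsub>A\<^esub> H h)) ?I"
    using k by (simp add: partial_skew_group_ring_def)
  also have "\<dots> = finsum A (\<lambda>g. \<alpha> g (\<alpha> (inv g) (F g) \<otimes>\<^bsub>A\<^esub> H (inv g \<otimes> k))) J"
    unfolding I
    by (subst A.M.finsum_reindex)
      (auto simp: inj_on_def J_def k intro!: D_subset skew_term_closed P_D[OF F] P_A[OF H])
  finally show ?thesis .
qed

lemma skew_mult_apply:
  assumes F: "F \<in> carrier P" and H: "H \<in> carrier P" and k: "k \<in> carrier G" and x: "x \<in> topspace X"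
    and S: "finite S" "S \<subseteq> carrier G" "supp F \<subseteq> S"
  shows "(F \<otimes>\<^bsub>P\<^esub> H) k x = finsum R (conv_term F H k x) S"
proof -
  let ?J = "{g \<in> carrier G. g \<in> supp F \<and> inv g \<otimes> k \<in> supp H}"
  have "(F \<otimes>\<^bsub>P\<^esub> H) k x
      = finsum R (\<lambda>g. \<alpha> g (\<alpha> (inv g) (F g) \<otimes>\<^bsub>A\<^esub> H (inv g \<otimes> k)) x) ?J"
    unfolding skew_mult_component[OF F H k]
    using x k by (intro lc_algebra_finsum_apply R.cring_axioms)
      (auto intro!: D_subset skew_term_closed P_D[OF F] P_A[OF H])
  also have "\<dots> = finsum R (conv_term F H k x) S"
  proof (rule R.add.finprod_mono_neutral_cong_left)
    show "conv_term F H k x g = \<zero>\<^bsub>R\<^esub>" if "g \<in> S - ?J" for g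
      using that S by (intro conv_term_zero F H k) auto
    show "\<alpha> g (\<alpha> (inv g) (F g) \<otimes>\<^bsub>A\<^esub> H (inv g \<otimes> k)) x = conv_term F H k x g" if "g \<in> ?J" for g
      using that x by (simp add: skew_term_apply conv_term_def)
    show "conv_term F H k x \<in> S \<rightarrow> carrier R"
      using S conv_term_closed[OF F H k] by auto
  qed (use S in auto)
  finally show ?thesis .
qed

lemma skew_mult_supp:
  assumes F: "F \<in> carrier P" and H: "H \<in> carrier P"
  shows "supp (F \<otimes>\<^bsub>P\<^esub> H) \<subseteq> (\<lambda>(g, h). g \<otimes> h) ` (supp F \<times> supp H)"
proof
  fix k assume k: "k \<in> supp (F \<otimes>\<^bsub>P\<^esub> H)"
  have "{g \<in> carrier G. g \<in> supp F \<and> inv g \<otimes> k \<in> supp H} \<noteq> {}"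
  proof
    assume J: "{g \<in> carrier G. g \<in> supp F \<and> inv g \<otimes> k \<in> supp H} = {}"
    have "(F \<otimes>\<^bsub>P\<^esub> H) k = \<zero>\<^bsub>A\<^esub>"
      using k skew_mult_component[OF F H, of k, unfolded J] by simp
    with k show False by simp
  qed
  then obtain g where "g \<in> supp F" "inv g \<otimes> k \<in> supp H" by blast
  moreover from this k have "k = g \<otimes> (inv g \<otimes> k)" by (simp add: m_assoc[symmetric])
  ultimately show "k \<in> (\<lambda>(g, h). g \<otimes> h) ` (supp F \<times> supp H)" by force
qed

lemma skew_mult_closed:
  assumes F: "F \<in> carrier P" and H: "H \<in> carrier P"
  shows "F \<otimes>\<^bsub>P\<^esub> H \<in> carrier P"
proof -
  have "(F \<otimes>\<^bsub>P\<^esub> H) k \<in> D k" if k: "k \<in> carrier G" for k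
  proof -
    have "(F \<otimes>\<^bsub>P\<^esub> H) k \<in> carrier A"
      unfolding skew_mult_component[OF F H k]
      using k by (intro A.M.finsum_closed) (auto intro!: D_subset skew_term_closed P_D[OF F] P_A[OF H])
    moreover have "(F \<otimes>\<^bsub>P\<^esub> H) k x = \<zero>\<^bsub>R\<^esub>" if x: "x \<in> topspace X" "x \<notin> Xg k" for x
    proof -
      have "conv_term F H k x g = \<zero>\<^bsub>R\<^esub>" if "g \<in> supp F" for g
        using that k x P_vanish[OF H] theta_inv_in_iff[of g k x] P_apply_closed[OF F]
        by (auto simp: conv_term_def theta_inv_topspace)
      then show ?thesis
        using skew_mult_apply[OF F H k x(1) P_supp_finite[OF F]] R.add.finprod_one_eqI[of "supp F"] by auto
    qed
    ultimately show ?thesis by (simp add: induced_ideal_def)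
  qed
  moreover have "finite (supp (F \<otimes>\<^bsub>P\<^esub> H))"
    using skew_mult_supp[OF F H] P_supp_finite[OF F] P_supp_finite[OF H]
    by (meson finite_SigmaI finite_imageI finite_subset)
  moreover have "F \<otimes>\<^bsub>P\<^esub> H \<in> extensional (carrier G)"
    by (simp add: partial_skew_group_ring_def)
  ultimately show ?thesis by (auto simp: P_carrier PiE_def)
qed

lemma skew_mult_assoc:
  assumes F: "F \<in> carrier P" and H: "H \<in> carrier P" and K: "K \<in> carrier P"
  shows "(F \<otimes>\<^bsub>P\<^esub> H) \<otimes>\<^bsub>P\<^esub> K = F \<otimes>\<^bsub>P\<^esub> (H \<otimes>\<^bsub>P\<^esub> K)"
proof (rule P_ext)
  fix k x assume k: "k \<in> carrier G" and x: "x \<in> topspace X"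
  define S T where "S = supp F" and "T = supp H"
  define U where "U = (\<lambda>(g, h). g \<otimes> h) ` (S \<times> T)"
  have fin: "finite S" "finite T" "finite U"
    using P_supp_finite[OF F] P_supp_finite[OF H] by (simp_all add: S_def T_def U_def)
  have G: "S \<subseteq> carrier G" "T \<subseteq> carrier G" "U \<subseteq> carrier G"
    by (auto simp: S_def T_def U_def)
  have U: "supp (F \<otimes>\<^bsub>P\<^esub> H) \<subseteq> U"
    unfolding U_def S_def T_def by (rule skew_mult_supp[OF F H])
  define M where "M s g = (if x \<in> Xg g \<and> x \<in> Xg s
      then F s x \<otimes>\<^bsub>R\<^esub> H (inv s \<otimes> g) (\<theta> (inv s) x) \<otimes>\<^bsub>R\<^esub> K (inv g \<otimes> k) (\<theta> (inv g) x) else \<zero>\<^bsub>R\<^esub>)"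
    for s g
  have M_closed: "M s g \<in> carrier R" if "s \<in> carrier G" "g \<in> carrier G" for s g
    using that x k F H K by (auto simp: M_def P_apply_closed theta_inv_topspace)
  have "((F \<otimes>\<^bsub>P\<^esub> H) \<otimes>\<^bsub>P\<^esub> K) k x = finsum R (conv_term (F \<otimes>\<^bsub>P\<^esub> H) K k x) U"
    by (rule skew_mult_apply[OF skew_mult_closed[OF F H] K k x fin(3) G(3) U])
  also have "\<dots> = (\<Oplus>\<^bsub>R\<^esub>g\<in>U. \<Oplus>\<^bsub>R\<^esub>s\<in>S. M s g)"
  proof (rule R.finsum_cong')
    fix g assume "g \<in> U"
    then have g: "g \<in> carrier G" using G by auto
    have FHg: "(F \<otimes>\<^bsub>P\<^esub> H) g x = finsum R (conv_term F H g x) S"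
      using skew_mult_apply[OF F H g x fin(1) G(1)] by (simp add: S_def)
    show "conv_term (F \<otimes>\<^bsub>P\<^esub> H) K k x g = (\<Oplus>\<^bsub>R\<^esub>s\<in>S. M s g)"
    proof (cases "x \<in> Xg g")
      case True
      have Kg: "K (inv g \<otimes> k) (\<theta> (inv g) x) \<in> carrier R"
        using K g k True by (simp add: P_apply_closed theta_inv_topspace)
      have "conv_term (F \<otimes>\<^bsub>P\<^esub> H) K k x g
          = (\<Oplus>\<^bsub>R\<^esub>s\<in>S. conv_term F H g x s \<otimes>\<^bsub>R\<^esub> K (inv g \<otimes> k) (\<theta> (inv g) x))"
        using True Kg conv_term_closed[OF F H g] G(1)
        by (simp add: conv_term_def[of "F \<otimes>\<^bsub>P\<^esub> H"] FHg R.finsum_ldistr[OF fin(1)] subset_iff Pi_iff)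
      also have "\<dots> = (\<Oplus>\<^bsub>R\<^esub>s\<in>S. M s g)"
      proof (rule R.finsum_cong')
        show "conv_term F H g x s \<otimes>\<^bsub>R\<^esub> K (inv g \<otimes> k) (\<theta> (inv g) x) = M s g" for s
          using True Kg by (simp add: M_def conv_term_def)
      qed (use G g M_closed in auto)
      finally show ?thesis .
    next
      case False
      then show ?thesis by (simp add: conv_term_def M_def)
    qed
  qed (use G in \<open>auto intro!: R.finsum_closed M_closed\<close>)
  also have "\<dots> = (\<Oplus>\<^bsub>R\<^esub>s\<in>S. \<Oplus>\<^bsub>R\<^esub>g\<in>U. M s g)"
    by (intro R.finsum_swap fin M_closed) (use G in blast)+
  also have "\<dots> = finsum R (conv_term F (H \<otimes>\<^bsub>P\<^esub> K) k x) S"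
  proof (rule R.finsum_cong')
    fix s assume sS: "s \<in> S"
    then have s: "s \<in> carrier G" using G by auto
    show "(\<Oplus>\<^bsub>R\<^esub>g\<in>U. M s g) = conv_term F (H \<otimes>\<^bsub>P\<^esub> K) k x s"
    proof (cases "x \<in> Xg s")
      case True
      let ?y = "\<theta> (inv s) x"
      have y: "?y \<in> topspace X" using s True by (rule theta_inv_topspace)
      have sk: "inv s \<otimes> k \<in> carrier G" using s k by simp
      have Fs: "F s x \<in> carrier R" using F s x by (rule P_apply_closed)
      have "conv_term F (H \<otimes>\<^bsub>P\<^esub> K) k x s
          = F s x \<otimes>\<^bsub>R\<^esub> finsum R (conv_term H K (inv s \<otimes> k) ?y) T"
        using True skew_mult_apply[OF H K sk y fin(2) G(2)]
        by (simp add: conv_term_def[of F] T_def)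
      also have "\<dots> = (\<Oplus>\<^bsub>R\<^esub>t\<in>T. F s x \<otimes>\<^bsub>R\<^esub> conv_term H K (inv s \<otimes> k) ?y t)"
        using conv_term_closed[OF H K sk] G(2) by (intro R.finsum_rdistr fin Fs) auto
      also have "\<dots> = (\<Oplus>\<^bsub>R\<^esub>t\<in>T. M s (s \<otimes> t))"
      proof (rule R.finsum_cong')
        fix t assume "t \<in> T"
        then have t: "t \<in> carrier G" using G by auto
        have cancel: "inv s \<otimes> (s \<otimes> t) = t" using s t by (simp add: m_assoc[symmetric])
        have inv_st: "inv (s \<otimes> t) \<otimes> k = inv t \<otimes> (inv s \<otimes> k)"
          using s t k by (simp add: inv_mult_group m_assoc)
        have iff: "?y \<in> Xg t \<longleftrightarrow> x \<in> Xg (s \<otimes> t)"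
          using theta_inv_in_iff[of s "s \<otimes> t" x] s t True cancel by simp
        show "F s x \<otimes>\<^bsub>R\<^esub> conv_term H K (inv s \<otimes> k) ?y t = M s (s \<otimes> t)"
        proof (cases "x \<in> Xg (s \<otimes> t)")
          case st: True
          have "\<theta> (inv t) ?y = \<theta> (inv (s \<otimes> t)) x"
            using theta_inv_comp[of s "s \<otimes> t" x] s t True st cancel by simp
          moreover have "H t ?y \<in> carrier R" using H t y by (rule P_apply_closed)
          moreover have "K (inv t \<otimes> (inv s \<otimes> k)) (\<theta> (inv (s \<otimes> t)) x) \<in> carrier R"
            using K t sk s st by (intro P_apply_closed theta_inv_topspace) auto
          ultimately show ?thesis
            using True st iff Fs by (simp add: M_def conv_term_def cancel inv_st R.m_assoc)
        next
          case False
          then show ?thesis using iff Fs by (simp add: M_def conv_term_def)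
        qed
      qed (use G s M_closed in auto)
      also have "\<dots> = finsum R (M s) ((\<otimes>) s ` T)"
        using s G by (intro R.finsum_reindex[symmetric]) (auto simp: inj_on_def subset_iff intro!: M_closed)
      also have "\<dots> = (\<Oplus>\<^bsub>R\<^esub>g\<in>U. M s g)"
      proof (rule R.add.finprod_mono_neutral_cong_left)
        show "(\<otimes>) s ` T \<subseteq> U" using sS by (auto simp: U_def)
        fix g assume g: "g \<in> U - (\<otimes>) s ` T"
        then have gG: "g \<in> carrier G" using G by auto
        then have "inv s \<otimes> g \<notin> T"
          using g s by (auto simp: m_assoc[symmetric] intro: rev_image_eqI)
        then have "H (inv s \<otimes> g) ?y = \<zero>\<^bsub>R\<^esub>"
          using s gG y by (intro P_off_supp) (auto simp: T_def)
        then show "M s g = \<zero>\<^bsub>R\<^esub>"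
          using Fs K gG k by (auto simp: M_def P_apply_closed theta_inv_topspace)
      qed (use fin G s M_closed in auto)
      finally show ?thesis ..
    next
      case False
      then show ?thesis by (simp add: conv_term_def M_def)
    qed
  qed (use G k conv_term_closed[OF F skew_mult_closed[OF H K]] in auto)
  also have "\<dots> = (F \<otimes>\<^bsub>P\<^esub> (H \<otimes>\<^bsub>P\<^esub> K)) k x"
    by (rule skew_mult_apply[OF F skew_mult_closed[OF H K] k x fin(1) G(1), symmetric]) (simp add: S_def)
  finally show "((F \<otimes>\<^bsub>P\<^esub> H) \<otimes>\<^bsub>P\<^esub> K) k x = (F \<otimes>\<^bsub>P\<^esub> (H \<otimes>\<^bsub>P\<^esub> K)) k x" .
qed (intro skew_mult_closed F H K)+

lemma r_algebra_P: "r_algebra R P"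
proof (intro r_algebra.intro r_algebra_axioms.intro)
  fix F H K assume F: "F \<in> carrier P" and H: "H \<in> carrier P" and K: "K \<in> carrier P"
  show "(F \<oplus>\<^bsub>P\<^esub> H) \<otimes>\<^bsub>P\<^esub> K = F \<otimes>\<^bsub>P\<^esub> K \<oplus>\<^bsub>P\<^esub> H \<otimes>\<^bsub>P\<^esub> K"
  proof (rule P_ext)
    fix k x assume k: "k \<in> carrier G" and x: "x \<in> topspace X"
    let ?FH = "F \<oplus>\<^bsub>P\<^esub> H"
    let ?S = "supp F \<union> supp H \<union> supp ?FH"
    have FH: "?FH \<in> carrier P" using F H by (rule P.M.a_closed)
    have S: "finite ?S" "?S \<subseteq> carrier G"
      using P_supp_finite[OF F] P_supp_finite[OF H] P_supp_finite[OF FH] by auto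
    have "finsum R (conv_term ?FH K k x) ?S
        = (\<Oplus>\<^bsub>R\<^esub>g\<in>?S. conv_term F K k x g \<oplus>\<^bsub>R\<^esub> conv_term H K k x g)"
    proof (rule R.finsum_cong')
      fix g assume "g \<in> ?S"
      then have g: "g \<in> carrier G" by auto
      show "conv_term ?FH K k x g = conv_term F K k x g \<oplus>\<^bsub>R\<^esub> conv_term H K k x g"
        using F H K g k x
        by (simp add: conv_term_def P_add_apply R.l_distr P_apply_closed theta_inv_topspace)
    qed (auto intro!: R.a_closed conv_term_closed F H K k)
    also have "\<dots> = finsum R (conv_term F K k x) ?S \<oplus>\<^bsub>R\<^esub> finsum R (conv_term H K k x) ?S"
      by (rule R.finsum_addf) (auto intro!: conv_term_closed F H K k)
    finally show "(?FH \<otimes>\<^bsub>P\<^esub> K) k x = (F \<otimes>\<^bsub>P\<^esub> K \<oplus>\<^bsub>P\<^esub> H \<otimes>\<^bsub>P\<^esub> K) k x"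
      using skew_mult_apply[OF FH K k x S] skew_mult_apply[OF F K k x S] skew_mult_apply[OF H K k x S]
      by (simp add: P_add_apply[OF k x] le_supI1)
  qed (intro skew_mult_closed P.M.a_closed F H K)+
  show "K \<otimes>\<^bsub>P\<^esub> (F \<oplus>\<^bsub>P\<^esub> H) = K \<otimes>\<^bsub>P\<^esub> F \<oplus>\<^bsub>P\<^esub> K \<otimes>\<^bsub>P\<^esub> H"
  proof (rule P_ext)
    fix k x assume k: "k \<in> carrier G" and x: "x \<in> topspace X"
    let ?FH = "F \<oplus>\<^bsub>P\<^esub> H" and ?S = "supp K"
    have FH: "?FH \<in> carrier P" using F H by (rule P.M.a_closed)
    have S: "finite ?S" "?S \<subseteq> carrier G" "supp K \<subseteq> ?S"
      using P_supp_finite[OF K] by auto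
    have "finsum R (conv_term K ?FH k x) ?S
        = (\<Oplus>\<^bsub>R\<^esub>g\<in>?S. conv_term K F k x g \<oplus>\<^bsub>R\<^esub> conv_term K H k x g)"
    proof (rule R.finsum_cong')
      fix g assume "g \<in> ?S"
      then have g: "g \<in> carrier G" by auto
      show "conv_term K ?FH k x g = conv_term K F k x g \<oplus>\<^bsub>R\<^esub> conv_term K H k x g"
        using F H K g k x
        by (simp add: conv_term_def P_add_apply R.r_distr P_apply_closed theta_inv_topspace)
    qed (auto intro!: R.a_closed conv_term_closed F H K k)
    also have "\<dots> = finsum R (conv_term K F k x) ?S \<oplus>\<^bsub>R\<^esub> finsum R (conv_term K H k x) ?S"
      by (rule R.finsum_addf) (auto intro!: conv_term_closed F H K k)
    finally show "(K \<otimes>\<^bsub>P\<^esub> ?FH) k x = (K \<otimes>\<^bsub>P\<^esub> F \<oplus>\<^bsub>P\<^esub> K \<otimes>\<^bsub>P\<^esub> H) k x"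
      using skew_mult_apply[OF K FH k x S] skew_mult_apply[OF K F k x S] skew_mult_apply[OF K H k x S]
      by (simp add: P_add_apply[OF k x])
  qed (intro skew_mult_closed P.M.a_closed F H K)+
next
  fix a F H assume a: "a \<in> carrier R" and F: "F \<in> carrier P" and H: "H \<in> carrier P"
  show "(a \<odot>\<^bsub>P\<^esub> F) \<otimes>\<^bsub>P\<^esub> H = a \<odot>\<^bsub>P\<^esub> (F \<otimes>\<^bsub>P\<^esub> H)"
  proof (rule P_ext)
    fix k x assume k: "k \<in> carrier G" and x: "x \<in> topspace X"
    let ?aF = "a \<odot>\<^bsub>P\<^esub> F"
    let ?S = "supp F \<union> supp ?aF"
    have aF: "?aF \<in> carrier P" using a F by (rule P.smult_closed)
    have S: "finite ?S" "?S \<subseteq> carrier G"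
      using P_supp_finite[OF F] P_supp_finite[OF aF] by auto
    have "finsum R (conv_term ?aF H k x) ?S = (\<Oplus>\<^bsub>R\<^esub>g\<in>?S. a \<otimes>\<^bsub>R\<^esub> conv_term F H k x g)"
    proof (rule R.finsum_cong')
      fix g assume "g \<in> ?S"
      then have g: "g \<in> carrier G" by auto
      show "conv_term ?aF H k x g = a \<otimes>\<^bsub>R\<^esub> conv_term F H k x g"
        using a F H g k x
        by (simp add: conv_term_def P_smult_apply R.m_assoc P_apply_closed theta_inv_topspace)
    qed (auto intro!: R.m_closed a conv_term_closed F H k)
    also have "\<dots> = a \<otimes>\<^bsub>R\<^esub> finsum R (conv_term F H k x) ?S"
      by (rule R.finsum_rdistr[symmetric]) (use S in \<open>auto intro!: a conv_term_closed F H k\<close>)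
    finally show "(?aF \<otimes>\<^bsub>P\<^esub> H) k x = (a \<odot>\<^bsub>P\<^esub> (F \<otimes>\<^bsub>P\<^esub> H)) k x"
      using skew_mult_apply[OF aF H k x S] skew_mult_apply[OF F H k x S]
      by (simp add: P_smult_apply[OF k x])
  qed (intro skew_mult_closed P.smult_closed a F H)+
  show "F \<otimes>\<^bsub>P\<^esub> (a \<odot>\<^bsub>P\<^esub> H) = a \<odot>\<^bsub>P\<^esub> (F \<otimes>\<^bsub>P\<^esub> H)"
  proof (rule P_ext)
    fix k x assume k: "k \<in> carrier G" and x: "x \<in> topspace X"
    let ?aH = "a \<odot>\<^bsub>P\<^esub> H" and ?S = "supp F"
    have aH: "?aH \<in> carrier P" using a H by (rule P.smult_closed)
    have S: "finite ?S" "?S \<subseteq> carrier G" "supp F \<subseteq> ?S" using P_supp_finite[OF F] by auto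
    have "finsum R (conv_term F ?aH k x) ?S = (\<Oplus>\<^bsub>R\<^esub>g\<in>?S. a \<otimes>\<^bsub>R\<^esub> conv_term F H k x g)"
    proof (rule R.finsum_cong')
      fix g assume "g \<in> ?S"
      then have g: "g \<in> carrier G" by auto
      show "conv_term F ?aH k x g = a \<otimes>\<^bsub>R\<^esub> conv_term F H k x g"
        using a F H g k x
        by (simp add: conv_term_def P_smult_apply R.m_lcomm P_apply_closed theta_inv_topspace)
    qed (auto intro!: R.m_closed a conv_term_closed F H k)
    also have "\<dots> = a \<otimes>\<^bsub>R\<^esub> finsum R (conv_term F H k x) ?S"
      by (rule R.finsum_rdistr[symmetric]) (use S in \<open>auto intro!: a conv_term_closed F H k\<close>)
    finally show "(F \<otimes>\<^bsub>P\<^esub> ?aH) k x = (a \<odot>\<^bsub>P\<^esub> (F \<otimes>\<^bsub>P\<^esub> H)) k x"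
      using skew_mult_apply[OF F aH k x S] skew_mult_apply[OF F H k x S]
      by (simp add: P_smult_apply[OF k x])
  qed (intro skew_mult_closed P.smult_closed a F H)+
qed (simp_all add: skew_mult_closed skew_mult_assoc P.module_axioms)

section \<open>The isomorphism with the Steinberg algebra\<close>

lemma topspace_arrows: "topspace (arrows \<Gamma>) = {(t, x). t \<in> carrier G \<and> x \<in> Xg t}"
  using Xg_subset by (auto simp: transformation_groupoid_def)

lemma continuous_map_Pair_arrows:
  assumes t: "t \<in> carrier G"
  shows "continuous_map (subtopology X (Xg t)) (arrows \<Gamma>) (Pair t)"
proof -
  have "continuous_map (subtopology X (Xg t)) (prod_topology (discrete_topology (carrier G)) X)
      (\<lambda>x. (t, x))"
    using t by (intro continuous_map_pairedI continuous_map_from_subtopology) auto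
  then show ?thesis
    using t by (auto simp: transformation_groupoid_def continuous_map_in_subtopology)
qed

lemma continuous_map_arrows:
  "continuous_map (arrows \<Gamma>) (discrete_topology (carrier G)) fst"
  "continuous_map (arrows \<Gamma>) X snd"
  by (auto simp: transformation_groupoid_def
      intro: continuous_map_from_subtopology continuous_map_fst continuous_map_snd)

definition to_groupoid where
  "to_groupoid F = (\<lambda>p\<in>topspace (arrows \<Gamma>). F (fst p) (snd p))"

definition from_groupoid where
  "from_groupoid f =
    (\<lambda>t\<in>carrier G. \<lambda>x\<in>topspace X. if x \<in> Xg t then f (t, x) else \<zero>\<^bsub>R\<^esub>)"

lemma to_groupoid_apply:
  "\<lbrakk>t \<in> carrier G; x \<in> Xg t\<rbrakk> \<Longrightarrow> to_groupoid F (t, x) = F t x"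
  by (simp add: to_groupoid_def topspace_arrows)

lemma to_groupoid_closed:
  assumes F: "F \<in> carrier P"
  shows "to_groupoid F \<in> lc_functions R (arrows \<Gamma>)"
proof (rule lc_functionsI)
  show "to_groupoid F \<in> topspace (arrows \<Gamma>) \<rightarrow>\<^sub>E carrier R"
    using P_apply_closed[OF F] Xg_subset by (auto simp: to_groupoid_def topspace_arrows)
  show "locally_constant_on_space (arrows \<Gamma>) (to_groupoid F)"
    unfolding locally_constant_on_space_def
  proof
    fix p assume "p \<in> topspace (arrows \<Gamma>)"
    then obtain t x where p: "p = (t, x)" and t: "t \<in> carrier G" and x: "x \<in> Xg t"
      by (auto simp: topspace_arrows)
    obtain U where U: "openin X U" "x \<in> U" "F t constant_on U"
      using P_A[OF F t] Xg_subset[OF t x]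
      by (auto simp: A_simps lc_functions_def locally_constant_on_space_def)
    have "openin (arrows \<Gamma>) (({t} \<times> U) \<inter> {(t, x). t \<in> carrier G \<and> x \<in> Xg t})"
      unfolding transformation_groupoid_def topological_groupoid.simps
      using t U by (intro openin_subtopology_Int) (auto simp: openin_prod_Times_iff)
    moreover have "to_groupoid F constant_on (({t} \<times> U) \<inter> {(t, x). t \<in> carrier G \<and> x \<in> Xg t})"
      using U(3) by (auto simp: constant_on_def to_groupoid_apply)
    ultimately show "\<exists>U. openin (arrows \<Gamma>) U \<and> p \<in> U \<and> to_groupoid F constant_on U"
      using p t x U(2) by blast
  qed
  show "compactin (arrows \<Gamma>) (\<Union>t\<in>supp F. Pair t ` supp_on R X (F t))"
  proof (rule compactin_Union)
    show "finite ((\<lambda>t. Pair t ` supp_on R X (F t)) ` supp F)"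
      using P_supp_finite[OF F] by simp
    fix K assume "K \<in> (\<lambda>t. Pair t ` supp_on R X (F t)) ` supp F"
    then obtain t where t: "t \<in> carrier G" and K: "K = Pair t ` supp_on R X (F t)" by auto
    have "supp_on R X (F t) \<subseteq> Xg t" using P_vanish[OF F t] by (auto simp: supp_on_def)
    then have "compactin (subtopology X (Xg t)) (supp_on R X (F t))"
      using P_A[OF F t] by (simp add: compactin_subtopology A_simps lc_functions_def)
    then show "compactin (arrows \<Gamma>) K"
      unfolding K by (rule image_compactin) (rule continuous_map_Pair_arrows[OF t])
  qed
  show "supp_on R (arrows \<Gamma>) (to_groupoid F) \<subseteq> (\<Union>t\<in>supp F. Pair t ` supp_on R X (F t))"
  proof
    fix p assume p: "p \<in> supp_on R (arrows \<Gamma>) (to_groupoid F)"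
    then obtain t x where tx: "p = (t, x)" "t \<in> carrier G" "x \<in> Xg t"
      by (auto simp: supp_on_def topspace_arrows)
    then have "F t x \<noteq> \<zero>\<^bsub>R\<^esub>" "x \<in> topspace X"
      using p Xg_subset by (auto simp: supp_on_def to_groupoid_apply)
    moreover from this have "t \<in> supp F" using P_off_supp tx(2) by blast
    ultimately show "p \<in> (\<Union>t\<in>supp F. Pair t ` supp_on R X (F t))"
      using tx(1) by (auto simp: supp_on_def)
  qed
qed

text \<open>Here it matters that each \<open>Xg t\<close> is closed: otherwise the extension by zero need not be
  locally constant at the boundary points of \<open>Xg t\<close>.\<close>

lemma from_groupoid_closed:
  assumes f: "f \<in> lc_functions R (arrows \<Gamma>)"
  shows "from_groupoid f \<in> carrier P"
proof -
  let ?K = "supp_on R (arrows \<Gamma>) f"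
  have K: "compactin (arrows \<Gamma>) ?K" using f by (simp add: lc_functions_def)
  have "from_groupoid f t \<in> lc_functions R X" if t: "t \<in> carrier G" for t
  proof (rule lc_functionsI)
    show "from_groupoid f t \<in> topspace X \<rightarrow>\<^sub>E carrier R"
      using t lc_functions_closed[OF f] by (auto simp: from_groupoid_def topspace_arrows)
    show "locally_constant_on_space X (from_groupoid f t)"
      unfolding locally_constant_on_space_def
    proof
      fix x assume x: "x \<in> topspace X"
      show "\<exists>U. openin X U \<and> x \<in> U \<and> from_groupoid f t constant_on U"
      proof (cases "x \<in> Xg t")
        case True
        then have "(t, x) \<in> topspace (arrows \<Gamma>)" using t by (simp add: topspace_arrows)
        then obtain V where V: "openin (arrows \<Gamma>) V" "(t, x) \<in> V" "f constant_on V"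
          using f by (auto simp: lc_functions_def locally_constant_on_space_def)
        have "openin (subtopology X (Xg t)) {y \<in> topspace (subtopology X (Xg t)). (t, y) \<in> V}"
          using continuous_map_Pair_arrows[OF t] V(1) by (rule openin_continuous_map_preimage)
        then have "openin X {y \<in> Xg t. (t, y) \<in> V}"
          using openin_open_subtopology[OF pa_open[OF t]] openin_subset[OF pa_open[OF t]]
          by (simp add: inf.absorb2)
        moreover have "from_groupoid f t constant_on {y \<in> Xg t. (t, y) \<in> V}"
          using V(3) t Xg_subset[OF t] by (auto simp: constant_on_def from_groupoid_def)
        ultimately show ?thesis using True V(2) by blast
      next
        case False
        then show ?thesis
          using closed[OF t] x t
          by (intro exI[of _ "topspace X - Xg t"]) (auto simp: constant_on_def from_groupoid_def)
      qed
    qed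
    show "compactin X (snd ` ?K)"
      using K continuous_map_arrows(2) by (rule image_compactin)
    show "supp_on R X (from_groupoid f t) \<subseteq> snd ` ?K"
      using t by (auto simp: supp_on_def from_groupoid_def topspace_arrows image_iff split: if_splits)
  qed
  then have D: "from_groupoid f t \<in> D t" if "t \<in> carrier G" for t
    using that by (simp add: induced_ideal_def A_simps) (simp add: from_groupoid_def)
  have "finite (fst ` ?K)"
    using image_compactin[OF K continuous_map_arrows(1)] by (simp add: compactin_discrete_topology)
  moreover have "supp (from_groupoid f) \<subseteq> fst ` ?K"
  proof
    fix t assume tf: "t \<in> supp (from_groupoid f)"
    have t: "t \<in> carrier G" and nz: "from_groupoid f t \<noteq> (\<lambda>x\<in>topspace X. \<zero>\<^bsub>R\<^esub>)"
      using tf by (simp_all add: A_simps)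
    have "\<exists>x\<in>Xg t. f (t, x) \<noteq> \<zero>\<^bsub>R\<^esub>"
    proof (rule ccontr)
      assume "\<not> ?thesis"
      then have "from_groupoid f t = (\<lambda>x\<in>topspace X. \<zero>\<^bsub>R\<^esub>)"
        using t by (auto simp: from_groupoid_def intro!: restrict_ext)
      with nz show False by simp
    qed
    then obtain x where "(t, x) \<in> ?K"
      using t by (auto simp: supp_on_def topspace_arrows)
    then show "t \<in> fst ` ?K" by (rule image_eqI[rotated]) simp
  qed
  ultimately have "finite (supp (from_groupoid f))" by (rule finite_subset[rotated])
  moreover have "from_groupoid f \<in> (\<Pi>\<^sub>E g\<in>carrier G. D g)"
    by (rule PiE_I) (simp_all add: D, simp add: from_groupoid_def)
  ultimately show ?thesis by (simp add: P_carrier)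
qed

lemma bij_betw_to_groupoid: "bij_betw to_groupoid (carrier P) (lc_functions R (arrows \<Gamma>))"
proof (rule bij_betw_byWitness[where f' = from_groupoid])
  show "\<forall>F\<in>carrier P. from_groupoid (to_groupoid F) = F"
  proof
    fix F assume F: "F \<in> carrier P"
    show "from_groupoid (to_groupoid F) = F"
      using P_vanish[OF F]
      by (intro P_ext from_groupoid_closed to_groupoid_closed F)
        (auto simp: from_groupoid_def to_groupoid_apply)
  qed
  show "\<forall>f\<in>lc_functions R (arrows \<Gamma>). to_groupoid (from_groupoid f) = f"
    by (auto intro!: lc_functions_ext simp: to_groupoid_def from_groupoid_def topspace_arrows Xg_subset)
qed (auto intro: to_groupoid_closed from_groupoid_closed)

lemma steinberg_mult_apply:
  assumes F: "F \<in> carrier P" and H: "H \<in> carrier P" and k: "k \<in> carrier G" and x: "x \<in> Xg k"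
  shows "(to_groupoid F \<otimes>\<^bsub>St\<^esub> to_groupoid H) (k, x) = finsum R (conv_term F H k x) (supp F)"
proof -
  define \<phi> where "\<phi> g = ((g, x), (inv g \<otimes> k, \<theta> (inv g) x))" for g
  let ?I = "{(c, d). (c, d) \<in> composable \<Gamma> \<and> gmult \<Gamma> c d = (k, x) \<and>
    to_groupoid F c \<noteq> \<zero>\<^bsub>R\<^esub> \<and> to_groupoid H d \<noteq> \<zero>\<^bsub>R\<^esub>}"
  define J where "J = {g \<in> carrier G. x \<in> Xg g \<and> F g x \<noteq> \<zero>\<^bsub>R\<^esub> \<and>
    H (inv g \<otimes> k) (\<theta> (inv g) x) \<noteq> \<zero>\<^bsub>R\<^esub>}"
  have xX: "x \<in> topspace X" using k x by (rule Xg_subset)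
  have in_Xg: "\<theta> (inv g) x \<in> Xg (inv g \<otimes> k)" if "g \<in> carrier G" "x \<in> Xg g" for g
    using theta_inv_in_iff[OF that(1) k that(2)] x by simp
  have I: "?I = \<phi> ` J"
  proof (intro subset_antisym subsetI)
    fix p assume "p \<in> ?I"
    then obtain g y t z where p: "p = ((g, y), (t, z))" and c: "((g, y), (t, z)) \<in> ?I"
      by (cases p) auto
    then have *: "g \<in> carrier G" "y \<in> Xg g" "t \<in> carrier G" "z \<in> Xg t" "z = \<theta> (inv g) y"
      "g \<otimes> t = k" "y = x"
      by (auto simp: composable_def topspace_arrows) (auto simp: transformation_groupoid_def)
    have t: "t = inv g \<otimes> k" by (subst inv_solve_left) (simp_all add: * k)
    have "F g x \<noteq> \<zero>\<^bsub>R\<^esub>" "H t z \<noteq> \<zero>\<^bsub>R\<^esub>"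
      using c *(1-4,7) by (simp_all add: to_groupoid_apply)
    then have "g \<in> J" using *(1,2,5,7) t by (simp add: J_def)
    moreover have "p = \<phi> g" using p *(5,7) t by (simp add: \<phi>_def)
    ultimately show "p \<in> \<phi> ` J" by blast
  next
    fix p assume "p \<in> \<phi> ` J"
    then obtain g where p: "p = \<phi> g" and g: "g \<in> carrier G" "x \<in> Xg g" "F g x \<noteq> \<zero>\<^bsub>R\<^esub>"
      "H (inv g \<otimes> k) (\<theta> (inv g) x) \<noteq> \<zero>\<^bsub>R\<^esub>"
      by (auto simp: J_def)
    have "(g, x) \<in> topspace (arrows \<Gamma>)" "(inv g \<otimes> k, \<theta> (inv g) x) \<in> topspace (arrows \<Gamma>)"
      using g k in_Xg by (auto simp: topspace_arrows)
    moreover have "gsource \<Gamma> (g, x) = grange \<Gamma> (inv g \<otimes> k, \<theta> (inv g) x)"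
      "gmult \<Gamma> (g, x) (inv g \<otimes> k, \<theta> (inv g) x) = (k, x)"
      using g k by (auto simp: transformation_groupoid_def m_assoc[symmetric])
    ultimately show "p \<in> ?I"
      using g k in_Xg by (simp add: p \<phi>_def composable_def to_groupoid_apply)
  qed
  have "(to_groupoid F \<otimes>\<^bsub>St\<^esub> to_groupoid H) (k, x)
      = finsum R (\<lambda>(c, d). to_groupoid F c \<otimes>\<^bsub>R\<^esub> to_groupoid H d) (\<phi> ` J)"
    using k x by (simp add: steinberg_algebra_def topspace_arrows I[symmetric])
  also have "\<dots> = finsum R (\<lambda>g. case \<phi> g of (c, d) \<Rightarrow> to_groupoid F c \<otimes>\<^bsub>R\<^esub> to_groupoid H d) J"
    using k in_Xg
    by (intro R.finsum_reindex)
      (auto simp: \<phi>_def J_def inj_on_def topspace_arrows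
        intro!: R.m_closed lc_functions_closed[OF to_groupoid_closed] F H)
  also have "\<dots> = finsum R (conv_term F H k x) (supp F)"
  proof (rule R.add.finprod_mono_neutral_cong_left)
    show "finite (supp F)" using F by (rule P_supp_finite)
    show "J \<subseteq> supp F"
    proof
      fix g assume "g \<in> J"
      then have "g \<in> carrier G" "F g x \<noteq> \<zero>\<^bsub>R\<^esub>" by (simp_all add: J_def)
      then show "g \<in> supp F" using P_off_supp xX by blast
    qed
    show "(case \<phi> g of (c, d) \<Rightarrow> to_groupoid F c \<otimes>\<^bsub>R\<^esub> to_groupoid H d) = conv_term F H k x g"
      if "g \<in> J" for g
      using that k in_Xg by (auto simp: \<phi>_def J_def to_groupoid_apply conv_term_def)
    show "conv_term F H k x g = \<zero>\<^bsub>R\<^esub>" if "g \<in> supp F - J" for g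
    proof (cases "x \<in> Xg g")
      case True
      have g: "g \<in> carrier G" and "g \<notin> J" using that by simp_all
      then have "F g x = \<zero>\<^bsub>R\<^esub> \<or> H (inv g \<otimes> k) (\<theta> (inv g) x) = \<zero>\<^bsub>R\<^esub>"
        using True by (simp add: J_def)
      moreover have "F g x \<in> carrier R" "H (inv g \<otimes> k) (\<theta> (inv g) x) \<in> carrier R"
        using g k xX True by (simp_all add: P_apply_closed F H theta_inv_topspace)
      ultimately show ?thesis by (auto simp: conv_term_def)
    qed (simp add: conv_term_def)
  qed (auto intro!: conv_term_closed F H k)
  finally show ?thesis .
qed

lemma to_groupoid_hom: "to_groupoid \<in> r_algebra_hom R P St"
proof -
  have "to_groupoid (F \<oplus>\<^bsub>P\<^esub> H) = to_groupoid F \<oplus>\<^bsub>St\<^esub> to_groupoid H" for F H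
    by (auto simp: to_groupoid_def steinberg_algebra_def topspace_arrows P_add_apply Xg_subset
        intro!: restrict_ext)
  moreover have "to_groupoid (a \<odot>\<^bsub>P\<^esub> F) = a \<odot>\<^bsub>St\<^esub> to_groupoid F" for a F
    by (auto simp: to_groupoid_def steinberg_algebra_def topspace_arrows P_smult_apply Xg_subset
        intro!: restrict_ext)
  moreover have "to_groupoid (F \<otimes>\<^bsub>P\<^esub> H) = to_groupoid F \<otimes>\<^bsub>St\<^esub> to_groupoid H"
    if F: "F \<in> carrier P" and H: "H \<in> carrier P" for F H
  proof (rule extensionalityI)
    fix p assume "p \<in> topspace (arrows \<Gamma>)"
    then obtain k x where "p = (k, x)" and k: "k \<in> carrier G" and x: "x \<in> Xg k"
      by (auto simp: topspace_arrows)
    then show "to_groupoid (F \<otimes>\<^bsub>P\<^esub> H) p = (to_groupoid F \<otimes>\<^bsub>St\<^esub> to_groupoid H) p"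
      using skew_mult_apply[OF F H k Xg_subset[OF k x] P_supp_finite[OF F]]
        steinberg_mult_apply[OF F H k x]
      by (simp add: to_groupoid_apply)
  qed (auto simp: to_groupoid_def steinberg_algebra_def)
  moreover have "to_groupoid \<in> carrier P \<rightarrow> carrier St"
    using to_groupoid_closed by (simp add: steinberg_algebra_def)
  ultimately show ?thesis unfolding r_algebra_hom_def by blast
qed

lemma skew_group_ring_isomorphic_steinberg: "r_algebras_isomorphic R P St"
proof -
  have bij: "bij_betw to_groupoid (carrier P) (carrier St)"
    using bij_betw_to_groupoid by (simp add: steinberg_algebra_def)
  moreover have "to_groupoid \<zero>\<^bsub>P\<^esub> = \<zero>\<^bsub>St\<^esub>"
    by (auto simp: to_groupoid_def steinberg_algebra_def partial_skew_group_ring_def A_simps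
        topspace_arrows Xg_subset intro!: restrict_ext)
  ultimately have "r_algebra R St"
    using r_algebra_hom_transport[OF r_algebra_P to_groupoid_hom] by blast
  then show ?thesis
    unfolding r_algebras_isomorphic_def using r_algebra_P to_groupoid_hom bij by blast
qed

end

theorem theorem3p2:
  fixes R :: "('r, 'm) ring_scheme"
    and G :: "('g, 'k) monoid_scheme"
    and X :: "'x topology"
    and Xg :: "'g \<Rightarrow> 'x set"
    and \<theta> :: "'g \<Rightarrow> 'x \<Rightarrow> 'x"
  assumes "cring R"
    and "group G"
    and "locally_compact_space X"
    and "Hausdorff_space X"
    and "totally_disconnected_space X"
    and "partial_action G X Xg \<theta>"
    and "\<forall>g\<in>carrier G. openin X (Xg g) \<and> closedin X (Xg g)"
  shows "r_algebras_isomorphic R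
    (partial_skew_group_ring G (lc_algebra R X) (induced_ideal R X Xg) (induced_map R G X Xg \<theta>))
    (steinberg_algebra R (transformation_groupoid G X Xg \<theta>))"
proof -
  interpret clopen_partial_action G X Xg \<theta> R
    using assms by (intro clopen_partial_action.intro clopen_partial_action_axioms.intro) blast+
  show ?thesis by (rule skew_group_ring_isomorphic_steinberg)
qed

end
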